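(* Let $X\in\mathbb{R}^{n\times n}$ be symmetric positive semidefinite, $r\ge1$, and let $U_0\in\mathbb{R}^{n\times r}$ with $U_0\ge0$. Choose $\lambda>0$ with $$\lambda>\tfrac12\left(\|X\|_2+\|X-U_0U_0^T\|_F-\sigma_n(X)\right),$$ and consider $$\min_{U,V\in\mathbb{R}^{n\times r}} f(U,V)=\tfrac12\|X-UV^{T}\|_F^2+\tfrac{\lambda}{2}\|U-V\|_F^2+\delta_+(U)+\delta_+(V).$$ Let $\{(U_k,V_k)\}_{k\ge0}$ be the iterates of any local search algorithm for this problem with initialization $V_0=U_0$. If the algorithm sequentially decreases the objective value (that is, $f(U_{k+1},V_{k+1})\le f(U_k,V_k)$ for all $k\ge0$) and the sequence $\{(U_k,V_k)\}$ converges to a critical point $(U^\star,V^\star)$ of $f$, then $U^\star=V^\star$, and $U^\star$ is a critical point of $$\min_{U\in\mathbb{R}^{n\times r}}\tfrac12\|X-UU^{T}\|_F^2\quad\text{subject to } U\ge 0 .$$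
   Context: "Local search algorithm" carries no further requirement: the statement concerns an arbitrary sequence of iterates with the stated properties. Matrix inequalities such as $U\ge 0$ are entrywise. $\|\cdot\|_2$ is the spectral norm, $\|\cdot\|_F$ the Frobenius norm, and $\sigma_n(X)$ is the $n$-th largest (smallest) singular value of $X$. $\delta_+$ is the indicator function of the nonnegative orthant: $\delta_+(U)=0$ if $U\ge0$ and $+\infty$ otherwise. $\partial\delta_+(U)$ is its convex subdifferential, $\{S\in\mathbb{R}^{n\times r}:\delta_+(U')\ge\delta_+(U)+\langle S,U'-U\rangle\ \forall U'\}$ if $U\ge0$, and $\emptyset$ otherwise. A critical point of $f$ is a pair $(U,V)$ with $0\in\partial_U f(U,V)$ and $0\in\partial_V f(U,V)$, where $\partial_U f(U,V)=(UV^T-X)V+\lambda(U-V)+\partial\delta_+(U)$ and $\partial_V f(U,V)=(UV^T-X)^TU-\lambda(U-V)+\partial\delta_+(V)$. A critical point of the symmetric problem is a $U$ with $0\in (UU^T-X)U+\partial\delta_+(U)$ (equivalently $0$ lies in the subdifferential of $\frac12\|X-UU^T\|_F^2+\delta_+(U)$). *)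

theory Defs
  imports "HOL-Analysis.Analysis"
begin

(* An n x r matrix has type real^'r^'n. On this type the library's norm and inner product
   are the Frobenius norm and the Frobenius inner product, and \<le> is entrywise. *)

definition psd_matrix :: "real^'n^'n \<Rightarrow> bool" where
  "psd_matrix X \<longleftrightarrow> transpose X = X \<and> (\<forall>v. 0 \<le> v \<bullet> (X *v v))"

definition spectral_norm :: "real^'m^'n \<Rightarrow> real" where
  "spectral_norm A = onorm (\<lambda>v. A *v v)"

(* The singular values are the square roots of the eigenvalues of X\<^sup>T X. *)
definition singular_values :: "real^'n^'n \<Rightarrow> real set" where
  "singular_values X =
     {s. 0 \<le> s \<and> (\<exists>v. v \<noteq> 0 \<and> (transpose X ** X) *v v = s\<^sup>2 *\<^sub>R v)}"

(* The n-th largest of the n singular values of an n x n matrix is the smallest one, so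
   multiplicities play no role. X\<^sup>T X is symmetric positive semidefinite, so the set is
   finite and nonempty. *)
definition least_singular_value :: "real^'n^'n \<Rightarrow> real" where
  "least_singular_value X = Min (singular_values X)"

definition delta_plus :: "real^'r^'n \<Rightarrow> ereal" where
  "delta_plus U = (if 0 \<le> U then 0 else \<infinity>)"

definition subdiff_delta_plus :: "real^'r^'n \<Rightarrow> (real^'r^'n) set" where
  "subdiff_delta_plus U =
     (if 0 \<le> U
      then {S. \<forall>U'. delta_plus U' \<ge> delta_plus U + ereal (S \<bullet> (U' - U))}
      else {})"

definition objective ::
    "real^'n^'n \<Rightarrow> real \<Rightarrow> real^'r^'n \<Rightarrow> real^'r^'n \<Rightarrow> ereal" where
  "objective X lam U V =
     ereal (1/2 * (norm (X - U ** transpose V))\<^sup>2 + lam/2 * (norm (U - V))\<^sup>2)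
       + delta_plus U + delta_plus V"

definition subdiff_U ::
    "real^'n^'n \<Rightarrow> real \<Rightarrow> real^'r^'n \<Rightarrow> real^'r^'n \<Rightarrow> (real^'r^'n) set" where
  "subdiff_U X lam U V =
     (\<lambda>S. (U ** transpose V - X) ** V + lam *\<^sub>R (U - V) + S) ` subdiff_delta_plus U"

definition subdiff_V ::
    "real^'n^'n \<Rightarrow> real \<Rightarrow> real^'r^'n \<Rightarrow> real^'r^'n \<Rightarrow> (real^'r^'n) set" where
  "subdiff_V X lam U V =
     (\<lambda>S. transpose (U ** transpose V - X) ** U - lam *\<^sub>R (U - V) + S) ` subdiff_delta_plus V"

definition critical_point ::
    "real^'n^'n \<Rightarrow> real \<Rightarrow> real^'r^'n \<Rightarrow> real^'r^'n \<Rightarrow> bool" where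
  "critical_point X lam U V \<longleftrightarrow> 0 \<in> subdiff_U X lam U V \<and> 0 \<in> subdiff_V X lam U V"

definition critical_point_sym :: "real^'n^'n \<Rightarrow> real^'r^'n \<Rightarrow> bool" where
  "critical_point_sym X U \<longleftrightarrow>
     0 \<in> (\<lambda>S. (U ** transpose U - X) ** U + S) ` subdiff_delta_plus U"

end

theory Submission
  imports Defs
begin

text \<open>
  Put \<open>D = U\<^sup>\<star> - V\<^sup>\<star>\<close>, \<open>M = U\<^sup>\<star>V\<^sup>\<star>\<^sup>T\<close> and \<open>E = M - X\<close>. Pair the difference of
  the two criticality equations with \<open>D\<close>. The subgradients of the indicator contribute a
  nonnegative term by monotonicity, and
  \<open>\<langle>E V\<^sup>\<star> - E\<^sup>T U\<^sup>\<star>, D\<rangle> + \<langle>E D, D\<rangle> = \<parallel>M - M\<^sup>T\<parallel>\<^sup>2 / 2 \<ge> 0\<close>, so that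
  \<open>2 \<lambda> \<parallel>D\<parallel>\<^sup>2 \<le> \<langle>E D, D\<rangle> \<le> \<parallel>E\<parallel> \<parallel>D\<parallel>\<^sup>2\<close> in Frobenius norms. Descent
  gives \<open>\<parallel>E\<parallel> \<le> \<parallel>X - U\<^sub>0U\<^sub>0\<^sup>T\<parallel>\<close>, which is less than \<open>2 \<lambda>\<close> because the least singular
  value is at most the spectral norm. Hence \<open>D = 0\<close>.
\<close>

section \<open>The Frobenius inner product\<close>

lemma matrix_mult_diff_ldistrib:
  fixes A :: "real^'m^'n" and B C :: "real^'k^'m"
  shows "A ** (B - C) = A ** B - A ** C"
  by (simp add: matrix_matrix_mult_def vec_eq_iff sum_subtractf algebra_simps)

lemma inner_transpose_transpose:
  fixes A B :: "real^'m^'n"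
  shows "transpose A \<bullet> transpose B = A \<bullet> B"
  unfolding inner_vec_def transpose_def by (simp, rule sum.swap)

lemma inner_matrix_mult_left:
  fixes A :: "real^'m^'n" and B :: "real^'k^'m" and C :: "real^'k^'n"
  shows "(A ** B) \<bullet> C = A \<bullet> (C ** transpose B)"
proof -
  have "(A ** B) \<bullet> C = (\<Sum>i\<in>UNIV. \<Sum>j\<in>UNIV. \<Sum>k\<in>UNIV. A$i$k * B$k$j * C$i$j)"
    by (simp add: inner_vec_def matrix_matrix_mult_def sum_distrib_right)
  also have "\<dots> = (\<Sum>i\<in>UNIV. \<Sum>k\<in>UNIV. \<Sum>j\<in>UNIV. A$i$k * B$k$j * C$i$j)"
    by (intro sum.cong refl sum.swap)
  also have "\<dots> = A \<bullet> (C ** transpose B)"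
    by (simp add: inner_vec_def matrix_matrix_mult_def transpose_def sum_distrib_left mult_ac)
  finally show ?thesis .
qed

text \<open>The entries of the product are inner products of rows; Cauchy-Schwarz bounds each one,
  and the resulting double sum factors.\<close>

lemma norm_matrix_mult_transpose_le:
  fixes A :: "real^'m^'n" and B :: "real^'m^'k"
  shows "norm (A ** transpose B) \<le> norm A * norm B"
proof -
  have sq: "(norm C)\<^sup>2 = (\<Sum>i\<in>UNIV. (norm (C$i))\<^sup>2)" for C :: "real^'x^'y"
    by (simp add: norm_vec_def L2_set_def sum_nonneg)
  have "(norm (A ** transpose B))\<^sup>2 = (\<Sum>i\<in>UNIV. \<Sum>j\<in>UNIV. (A$i \<bullet> B$j)\<^sup>2)"
    unfolding sq[of "A ** transpose B"]
    by (simp add: norm_vec_def L2_set_def sum_nonneg matrix_matrix_mult_def transpose_def inner_vec_def)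
  also have "\<dots> \<le> (\<Sum>i\<in>UNIV. \<Sum>j\<in>UNIV. (norm (A$i))\<^sup>2 * (norm (B$j))\<^sup>2)"
    by (intro sum_mono) (metis Cauchy_Schwarz_ineq power2_norm_eq_inner)
  also have "\<dots> = (norm A * norm B)\<^sup>2"
    by (simp add: sq power_mult_distrib sum_product)
  finally show ?thesis
    by (rule power2_le_imp_le) simp
qed

lemma inner_matrix_mult_self_le:
  fixes E :: "real^'n^'n" and D :: "real^'r^'n"
  shows "(E ** D) \<bullet> D \<le> norm E * (norm D)\<^sup>2"
proof -
  have "(E ** D) \<bullet> D \<le> norm E * norm (D ** transpose D)"
    by (simp add: inner_matrix_mult_left norm_cauchy_schwarz)
  also have "\<dots> \<le> norm E * (norm D)\<^sup>2"
    by (simp add: mult_left_mono norm_matrix_mult_transpose_le power2_eq_square)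
  finally show ?thesis .
qed

lemma tendsto_matrix_mult_transpose:
  fixes f :: "'a \<Rightarrow> real^'m^'n" and g :: "'a \<Rightarrow> real^'m^'k"
  assumes "(f \<longlongrightarrow> A) F" "(g \<longlongrightarrow> B) F"
  shows "((\<lambda>x. f x ** transpose (g x)) \<longlongrightarrow> A ** transpose B) F"
  unfolding matrix_matrix_mult_def transpose_def
  by (intro vec_tendstoI) (auto intro!: tendsto_intros assms)

section \<open>Singular values\<close>

lemma norm_matrix_mult_eigenvector:
  fixes X :: "real^'m^'n"
  assumes "(transpose X ** X) *v v = c *\<^sub>R v"
  shows "(norm (X *v v))\<^sup>2 = c * (norm v)\<^sup>2"
proof -
  have "(norm (X *v v))\<^sup>2 = v \<bullet> ((transpose X ** X) *v v)"
    by (simp add: power2_norm_eq_inner inner_commute[of v] dot_lmul_matrix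
        flip: matrix_vector_mul_assoc)
  then show ?thesis
    by (simp add: assms power2_norm_eq_inner)
qed

text \<open>Eigenvectors of the symmetric \<open>transpose X ** X\<close> for distinct eigenvalues
  are orthogonal, hence independent. Finiteness is half of what places \<open>Min\<close> inside the
  set.\<close>

lemma finite_singular_values:
  fixes X :: "real^'n^'n"
  shows "finite (singular_values X)"
proof -
  define A where "A = transpose X ** X"
  define v where "v s = (SOME v. v \<noteq> 0 \<and> A *v v = s\<^sup>2 *\<^sub>R v)" for s
  have v: "v s \<noteq> 0 \<and> A *v v s = s\<^sup>2 *\<^sub>R v s" if "s \<in> singular_values X" for s
    unfolding v_def by (rule someI_ex) (use that in \<open>auto simp: singular_values_def A_def\<close>)
  have sym: "(A *v x) \<bullet> y = x \<bullet> (A *v y)" for x y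
    by (metis A_def dot_lmul_matrix matrix_transpose_mul transpose_matrix_vector transpose_transpose)
  have orth: "v s \<bullet> v t = 0"
    if "s \<in> singular_values X" "t \<in> singular_values X" "s \<noteq> t" for s t
  proof -
    have "s\<^sup>2 * (v s \<bullet> v t) = t\<^sup>2 * (v s \<bullet> v t)"
      using sym[of "v s" "v t"] v[OF that(1)] v[OF that(2)] by simp
    \<comment> \<open>Squaring is injective on singular values because they are nonnegative.\<close>
    moreover have "s\<^sup>2 \<noteq> t\<^sup>2"
      using that by (auto simp: singular_values_def)
    ultimately show ?thesis by simp
  qed
  have inj: "inj_on v (singular_values X)"
    \<comment> \<open>A common eigenvector for two distinct values would be orthogonal to itself,
      hence zero.\<close>
    by (rule inj_onI) (metis inner_eq_zero_iff orth v)
  have "pairwise orthogonal (v ` singular_values X)"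
    by (auto simp: pairwise_def orthogonal_def intro!: orth)
  moreover have "0 \<notin> v ` singular_values X"
    using v by force
  ultimately have "finite (v ` singular_values X)"
    using pairwise_orthogonal_independent independent_imp_finite by blast
  then show ?thesis
    using inj finite_imageD by blast
qed

text \<open>The maximal value of \<open>\<parallel>X v\<parallel>\<close> on the unit sphere is a singular value: at a maximiser \<open>v\<close>
  the nonnegative quadratic form \<open>m\<^sup>2\<parallel>w\<parallel>\<^sup>2 - \<parallel>X w\<parallel>\<^sup>2\<close> vanishes, hence so does its gradient.\<close>

lemma singular_values_nonempty:
  fixes X :: "real^'n^'n"
  shows "singular_values X \<noteq> {}"
proof -
  have "continuous_on (sphere 0 1) (\<lambda>v. norm (X *v v))"
    by (intro continuous_intros)
  moreover have "sphere (0::real^'n) 1 \<noteq> {}"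
    by simp
  ultimately obtain v where v: "norm v = 1"
    and max: "\<And>w. norm w = 1 \<Longrightarrow> norm (X *v w) \<le> norm (X *v v)"
    using continuous_attains_sup[OF compact_sphere, of "0::real^'n" 1 "\<lambda>v. norm (X *v v)"]
    by auto
  define m where "m = norm (X *v v)"
  have bound: "norm (X *v w) \<le> m * norm w" for w
  proof (cases "w = 0")
    case False
    have "norm (X *v (w /\<^sub>R norm w)) \<le> m"
      unfolding m_def using False by (intro max) simp
    then show ?thesis
      using False by (simp add: matrix_vector_mult_scaleR field_simps)
  qed simp
  define q where "q w = m\<^sup>2 * (w \<bullet> w) - (X *v w) \<bullet> (X *v w)" for w
  have q_nonneg: "0 \<le> q w" for w
    using power_mono[OF bound[of w], of 2]
    by (simp add: q_def power_mult_distrib power2_norm_eq_inner)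
  \<comment> \<open>Half the gradient of \<open>q\<close> at \<open>v\<close>.\<close>
  define g where "g = m\<^sup>2 *\<^sub>R v - (transpose X ** X) *v v"
  have vXX: "((transpose X ** X) *v v) \<bullet> w = (X *v v) \<bullet> (X *v w)" for w
    by (simp add: dot_lmul_matrix flip: matrix_vector_mul_assoc)
  have expand: "q (v - t *\<^sub>R g) = t\<^sup>2 * q g - 2 * t * (g \<bullet> g)" for t
  proof -
    have "(X *v v) \<bullet> (X *v v) = m\<^sup>2"
      by (simp add: m_def power2_norm_eq_inner)
    moreover have "v \<bullet> v = 1"
      using v by (simp add: norm_eq_1)
    moreover have "g \<bullet> g = m\<^sup>2 * (v \<bullet> g) - (X *v v) \<bullet> (X *v g)"
      by (subst (1) g_def) (simp add: inner_diff_left vXX)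
    moreover have "q (v - t *\<^sub>R g) = m\<^sup>2 * (v \<bullet> v) - (X *v v) \<bullet> (X *v v)
        - 2 * t * (m\<^sup>2 * (v \<bullet> g) - (X *v v) \<bullet> (X *v g)) + t\<^sup>2 * q g"
      by (simp add: q_def matrix_vector_mult_diff_distrib matrix_vector_mult_scaleR inner_diff
          inner_commute algebra_simps power2_eq_square)
    ultimately show ?thesis
      by simp
  qed
  have "g = 0"
  proof (rule ccontr)
    assume "g \<noteq> 0"
    then have gg: "0 < g \<bullet> g" by simp
    \<comment> \<open>A step this short keeps the quadratic term of \<open>expand\<close> below the
      linear one, so \<open>q\<close> would turn negative. The \<open>+ 1\<close> covers
      \<open>q g = 0\<close>.\<close>
    define t where "t = (g \<bullet> g) / (q g + 1)"
    have t: "0 < t" "t * q g \<le> g \<bullet> g"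
      using gg q_nonneg[of g] by (auto simp: t_def field_simps)
    have "t * (2 * (g \<bullet> g)) \<le> t * (t * q g)"
      using q_nonneg[of "v - t *\<^sub>R g"] by (simp add: expand power2_eq_square algebra_simps)
    then have "2 * (g \<bullet> g) \<le> t * q g"
      using t(1) by simp
    with t(2) gg show False
      by linarith
  qed
  then have "m \<in> singular_values X"
    using v unfolding singular_values_def g_def by (auto simp: m_def intro!: exI[of _ v])
  then show ?thesis by blast
qed

text \<open>A singular value is the factor by which \<open>X\<close> stretches the norm of its
  eigenvector, and the operator norm bounds every such factor.\<close>

lemma least_singular_value_le_spectral_norm:
  fixes X :: "real^'n^'n"
  shows "least_singular_value X \<le> spectral_norm X"
proof -
  have "least_singular_value X \<in> singular_values X"
    unfolding least_singular_value_def
    by (rule Min_in[OF finite_singular_values singular_values_nonempty])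
  then obtain v where v: "v \<noteq> 0" "0 \<le> least_singular_value X"
    "(transpose X ** X) *v v = (least_singular_value X)\<^sup>2 *\<^sub>R v"
    by (auto simp: singular_values_def)
  have "(least_singular_value X * norm v)\<^sup>2 = (norm (X *v v))\<^sup>2"
    using norm_matrix_mult_eigenvector[OF v(3)] by (simp add: power_mult_distrib)
  then have "least_singular_value X * norm v = norm (X *v v)"
    using v(2) by simp
  also have "\<dots> \<le> spectral_norm X * norm v"
    unfolding spectral_norm_def by (rule onorm) (rule matrix_vector_mul_bounded_linear)
  finally show ?thesis
    using v(1) by simp
qed

section \<open>Critical points and descent\<close>

lemma subdiff_delta_plus_nonneg: "S \<in> subdiff_delta_plus U \<Longrightarrow> 0 \<le> U"
  by (auto simp: subdiff_delta_plus_def split: if_splits)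

lemma subdiff_delta_plus_inner_le:
  assumes "S \<in> subdiff_delta_plus U" "0 \<le> U'"
  shows "S \<bullet> (U' - U) \<le> 0"
proof -
  have "delta_plus U + ereal (S \<bullet> (U' - U)) \<le> delta_plus U'"
    using assms(1) by (auto simp: subdiff_delta_plus_def split: if_splits)
  then show ?thesis
    using assms subdiff_delta_plus_nonneg[OF assms(1)] by (simp add: delta_plus_def)
qed

text \<open>A finite bound forces both indicators to vanish, leaving only the smooth part.\<close>

lemma objective_finite_le:
  assumes "objective X lam U V \<le> ereal c"
  shows "1/2 * (norm (X - U ** transpose V))\<^sup>2 + lam/2 * (norm (U - V))\<^sup>2 \<le> c"
  using assms by (auto simp: objective_def delta_plus_def split: if_splits)

lemma residual_le_of_descent:
  fixes U V :: "nat \<Rightarrow> real^'r^'n"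
  assumes "0 \<le> U0" "0 < lam" "U 0 = U0" "V 0 = U0"
    and descent: "\<And>k. objective X lam (U (Suc k)) (V (Suc k)) \<le> objective X lam (U k) (V k)"
    and lim: "(\<lambda>k. (U k, V k)) \<longlonglongrightarrow> (Us, Vs)"
  shows "norm (X - Us ** transpose Vs) \<le> norm (X - U0 ** transpose U0)"
proof -
  have init: "objective X lam (U 0) (V 0) = ereal (1/2 * (norm (X - U0 ** transpose U0))\<^sup>2)"
    using assms(1,3,4) by (simp add: objective_def delta_plus_def)
  have "norm (X - U k ** transpose (V k)) \<le> norm (X - U0 ** transpose U0)" for k
  proof -
    have "objective X lam (U k) (V k) \<le> objective X lam (U 0) (V 0)"
      by (rule lift_Suc_antimono_le[of "\<lambda>k. objective X lam (U k) (V k)"]) (auto intro: descent)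
    from objective_finite_le[OF this[unfolded init]]
    have "(norm (X - U k ** transpose (V k)))\<^sup>2 + lam * (norm (U k - V k))\<^sup>2
        \<le> (norm (X - U0 ** transpose U0))\<^sup>2"
      by simp
    moreover have "0 \<le> lam * (norm (U k - V k))\<^sup>2"
      using assms(2) by simp
    ultimately have "(norm (X - U k ** transpose (V k)))\<^sup>2 \<le> (norm (X - U0 ** transpose U0))\<^sup>2"
      by linarith
    then show ?thesis
      by (rule power2_le_imp_le) simp
  qed
  moreover have "(\<lambda>k. norm (X - U k ** transpose (V k))) \<longlonglongrightarrow> norm (X - Us ** transpose Vs)"
    using tendsto_fst[OF lim] tendsto_snd[OF lim]
    by (auto intro!: tendsto_intros tendsto_matrix_mult_transpose)
  ultimately show ?thesis
    by (intro Lim_bounded[of _ _ 0]) auto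
qed

lemma residual_cross_term_ge:
  fixes X :: "real^'n^'n" and U V :: "real^'r^'n"
  assumes sym: "transpose X = X"
  defines "E \<equiv> U ** transpose V - X"
  shows "- ((E ** (U - V)) \<bullet> (U - V)) \<le> (E ** V - transpose E ** U) \<bullet> (U - V)"
proof -
  define M where "M = U ** transpose V"
  have tM: "V ** transpose U = transpose M"
    by (simp add: M_def matrix_transpose_mul)
  \<comment> \<open>\<open>U ** transpose U\<close> is symmetric, so its pairings with
    \<open>E\<close> and \<open>transpose E\<close> cancel in the expansion.\<close>
  have "transpose E \<bullet> (U ** transpose U) = E \<bullet> (U ** transpose U)"
    using inner_transpose_transpose[of E "U ** transpose U"] by (simp add: matrix_transpose_mul)
  moreover have "transpose E \<bullet> transpose M = E \<bullet> M"
    by (rule inner_transpose_transpose)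
  ultimately have "(E ** V - transpose E ** U) \<bullet> (U - V) + (E ** (U - V)) \<bullet> (U - V)
      = E \<bullet> M - E \<bullet> transpose M"
    by (simp add: matrix_mult_diff_ldistrib inner_diff inner_matrix_mult_left tM
        flip: M_def)
  \<comment> \<open>The symmetric \<open>X\<close> pairs equally with \<open>M\<close> and its
    transpose, so it drops out.\<close>
  also have "\<dots> = M \<bullet> M - M \<bullet> transpose M"
    using inner_transpose_transpose[of X M] by (simp add: E_def inner_diff sym flip: M_def)
  also have "\<dots> = M \<bullet> M - transpose M \<bullet> M"
    by (simp add: inner_commute)
  also have "\<dots> \<ge> 0"
  proof -
    have "norm (transpose M) = norm M"
      by (simp add: norm_eq inner_transpose_transpose)
    then show ?thesis
      using norm_cauchy_schwarz[of "transpose M" M] by (simp add: dot_square_norm power2_eq_square)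
  qed
  finally show ?thesis by linarith
qed

lemma critical_point_eq:
  fixes X :: "real^'n^'n" and U V :: "real^'r^'n"
  assumes sym: "transpose X = X" and crit: "critical_point X lam U V"
    and small: "norm (X - U ** transpose V) < 2 * lam"
  shows "U = V"
proof (rule ccontr)
  assume "U \<noteq> V"
  define E where "E = U ** transpose V - X"
  define D where "D = U - V"
  obtain S where S: "S \<in> subdiff_delta_plus U" and eqU: "0 = E ** V + lam *\<^sub>R D + S"
    using crit unfolding critical_point_def subdiff_U_def E_def D_def by (elim conjE imageE)
  obtain T where T: "T \<in> subdiff_delta_plus V" and eqV: "0 = transpose E ** U - lam *\<^sub>R D + T"
    using crit unfolding critical_point_def subdiff_V_def E_def D_def by (elim conjE imageE)
  \<comment> \<open>Each subgradient is tested at the other factor, which is feasible because its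
    own subdifferential is nonempty.\<close>
  have "S \<bullet> (V - U) \<le> 0" "T \<bullet> (U - V) \<le> 0"
    using S T subdiff_delta_plus_inner_le subdiff_delta_plus_nonneg by blast+
  then have mono: "T \<bullet> D \<le> S \<bullet> D"
    by (simp add: D_def inner_diff)
  have "(E ** V) \<bullet> D + lam * (norm D)\<^sup>2 + S \<bullet> D = 0"
    using arg_cong[OF eqU, of "\<lambda>W. W \<bullet> D"] by (simp add: inner_add_left power2_norm_eq_inner)
  moreover have "(transpose E ** U) \<bullet> D - lam * (norm D)\<^sup>2 + T \<bullet> D = 0"
    using arg_cong[OF eqV, of "\<lambda>W. W \<bullet> D"]
    by (simp add: inner_add_left inner_diff_left power2_norm_eq_inner)
  ultimately have "(E ** V - transpose E ** U) \<bullet> D + 2 * lam * (norm D)\<^sup>2 + S \<bullet> D - T \<bullet> D = 0"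
    by (simp add: inner_diff_left)
  moreover have "- ((E ** D) \<bullet> D) \<le> (E ** V - transpose E ** U) \<bullet> D"
    unfolding E_def D_def by (rule residual_cross_term_ge[OF sym])
  ultimately have "2 * lam * (norm D)\<^sup>2 \<le> norm E * (norm D)\<^sup>2"
    using mono inner_matrix_mult_self_le[of E D] by linarith
  moreover have "0 < (norm D)\<^sup>2"
    using \<open>U \<noteq> V\<close> by (simp add: D_def)
  ultimately have "2 * lam \<le> norm E"
    by simp
  with small show False
    by (simp add: E_def norm_minus_commute)
qed

text \<open>On the diagonal the penalty gradient vanishes, and the equation in \<open>U\<close>
  becomes the symmetric one.\<close>

lemma critical_point_sym_of_critical_point:
  "critical_point X lam U U \<Longrightarrow> critical_point_sym X U"
  by (simp add: critical_point_def subdiff_U_def critical_point_sym_def)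

theorem theorem2:
  fixes X :: "real^'n^'n"
    and U0 Ustar Vstar :: "real^'r^'n"
    and lam :: real
    and U V :: "nat \<Rightarrow> real^'r^'n"
  assumes "psd_matrix X"
    and "0 \<le> U0"
    and "lam > 0"
    and "lam > 1/2 * (spectral_norm X + norm (X - U0 ** transpose U0) - least_singular_value X)"
    and "U 0 = U0" and "V 0 = U0"
    and "\<And>k. objective X lam (U (Suc k)) (V (Suc k)) \<le> objective X lam (U k) (V k)"
    and "(\<lambda>k. (U k, V k)) \<longlonglongrightarrow> (Ustar, Vstar)"
    and "critical_point X lam Ustar Vstar"
  shows "Ustar = Vstar \<and> critical_point_sym X Ustar"
proof -
  have "norm (X - Ustar ** transpose Vstar) \<le> norm (X - U0 ** transpose U0)"
    by (rule residual_le_of_descent[OF assms(2,3,5-8)])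
  also have "\<dots> < 2 * lam"
    using assms(4) least_singular_value_le_spectral_norm[of X] by simp
  finally have "Ustar = Vstar"
    using assms(1,9) critical_point_eq by (auto simp: psd_matrix_def)
  then show ?thesis
    using assms(9) critical_point_sym_of_critical_point by blast
qed

end
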